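(* Let $X\subset\mathbb{R}^s$ be open, let $f:X\to\mathbb{R}^n$ and $g:X\to\mathbb{R}^m$, and let $C\subset\mathbb{R}^n$, $K\subset\mathbb{R}^m$ be closed convex pointed cones with vertex at the origin, with $\operatorname{int}(C)\neq\emptyset$. Let $\bar x\in X$ be a feasible point, i.e. $g(\bar x)\in -K$. Suppose that $f$ and $g$ are locally Lipschitz and that there exist $\bar\lambda\in C^*$, $\bar\lambda\neq0$, and $\bar\mu\in K^*$ such that $\bar\mu\cdot g(\bar x)=0$ and $$(\bar\lambda\cdot f)^{(1)}_-(\bar x;u)+(\bar\mu\cdot g)^{(1)}_-(\bar x;u)>0\quad\text{for every direction } u\in\mathbb{R}^s,\ u\neq0.$$ Then $\bar x$ is a (first-order) weak isolated local minimizer of the problem (P): minimize $f(x)$ with respect to the cone $C$ subject to $g(x)\in -K$.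
   Context: The feasible set is $S=\{x\in X : g(x)\in -K\}$. The positive polar cone is $C^*=\{\lambda\in\mathbb{R}^n : \lambda\cdot x\ge 0 \text{ for all } x\in C\}$, and similarly $K^*\subset\mathbb{R}^m$. For a scalar function $h$, the lower Dini directional derivative at $x$ in direction $u$ is $h^{(1)}_-(x;u)=\liminf_{t\downarrow0}t^{-1}[h(x+tu)-h(x)]$. Here $\bar\lambda\cdot f$ and $\bar\mu\cdot g$ denote the scalar functions $x\mapsto\bar\lambda\cdot f(x)$ and $x\mapsto\bar\mu\cdot g(x)$. A point $\bar x\in S$ is a (first-order) weak isolated local minimizer if there exist $\lambda\in C^*$, $\lambda\neq0$, and a number $\epsilon>0$ such that $\lambda\cdot f(x)\ge\lambda\cdot f(\bar x)+\epsilon\|x-\bar x\|$ for all $x\in N_\epsilon(\bar x)\cap S$, where $N_\epsilon(\bar x)$ is the ball of radius $\epsilon$ centered at $\bar x$. *)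

theory Defs
  imports "HOL-Analysis.Analysis"
begin

text \<open>
  Functions on an open set \<open>X\<close> are total HOL functions; only their values on \<open>X\<close> matter below.
\<close>

definition positive_polar :: "'a::real_inner set \<Rightarrow> 'a set" where
  "positive_polar C = {l. \<forall>x\<in>C. 0 \<le> l \<bullet> x}"

text \<open>\<open>convex_cone\<close> includes nonemptiness, so the vertex \<open>0\<close> belongs to the cone.\<close>

definition closed_convex_pointed_cone :: "'a::real_normed_vector set \<Rightarrow> bool" where
  "closed_convex_pointed_cone C \<longleftrightarrow> closed C \<and> convex_cone C \<and> C \<inter> uminus ` C = {0}"

definition locally_lipschitz_on :: "'a::metric_space set \<Rightarrow> ('a \<Rightarrow> 'b::metric_space) \<Rightarrow> bool" where
  "locally_lipschitz_on X f \<longleftrightarrow> (\<forall>x\<in>X. \<exists>r>0. \<exists>L. L-lipschitz_on (cball x r \<inter> X) f)"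

lemma locally_lipschitz_on_iff_local_lipschitz:
  "locally_lipschitz_on X f \<longleftrightarrow> local_lipschitz {0::real} X (\<lambda>_. f)"
proof -
  have "(\<forall>t\<in>cball 0 r \<inter> {0::real}. P) \<longleftrightarrow> P" if "r > 0" for r P
    using that by auto
  then show ?thesis
    unfolding locally_lipschitz_on_def local_lipschitz_def by (simp cong: conj_cong)
qed

text \<open>
  The derivative takes extended real values.  At a point where the function is locally Lipschitz
  it is finite, so a sum of two such derivatives never has the form \<open>\<infinity> + (-\<infinity>)\<close>.
\<close>

definition lower_dini_deriv :: "('a::real_normed_vector \<Rightarrow> real) \<Rightarrow> 'a \<Rightarrow> 'a \<Rightarrow> ereal" where
  "lower_dini_deriv h x u =
     Liminf (at_right (0::real)) (\<lambda>t. ereal ((h (x + t *\<^sub>R u) - h x) / t))"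

definition feasible_set :: "'a set \<Rightarrow> ('a \<Rightarrow> 'b::real_vector) \<Rightarrow> 'b set \<Rightarrow> 'a set" where
  "feasible_set X g K = {x \<in> X. g x \<in> uminus ` K}"

definition weak_isolated_local_minimizer ::
  "'s::real_normed_vector set \<Rightarrow> ('s \<Rightarrow> 'n::real_inner) \<Rightarrow> ('s \<Rightarrow> 'm::real_vector) \<Rightarrow>
   'n set \<Rightarrow> 'm set \<Rightarrow> 's \<Rightarrow> bool" where
  "weak_isolated_local_minimizer X f g C K x0 \<longleftrightarrow>
     x0 \<in> feasible_set X g K \<and>
     (\<exists>l \<in> positive_polar C. l \<noteq> 0 \<and>
       (\<exists>\<epsilon>>0. \<forall>x \<in> ball x0 \<epsilon> \<inter> feasible_set X g K.
          l \<bullet> f x \<ge> l \<bullet> f x0 + \<epsilon> * norm (x - x0)))"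

end

theory Submission
  imports Defs
begin

text \<open>
  The complementarity scalarisation \<open>h = \<lambda> \<bullet> f + \<mu> \<bullet> g\<close> is locally Lipschitz, and because lower
  limits are superadditive, the derivative condition makes \<open>h\<close> increase at a positive linear rate
  along every ray from \<open>x\<close>.  A Lipschitz function that grows linearly along one ray
  also does so along all nearby rays, with half the rate and for step lengths bounded independently
  of the ray (\<open>linear_growth_along_nearby_rays\<close>).  As the unit sphere is compact, finitely many such bundles
  of rays cover all directions, so \<open>h\<close> has one positive growth rate on a whole ball around \<open>x\<close>
  (\<open>linear_growth_near_point\<close>).  At a feasible point \<open>y\<close> one has \<open>\<mu> \<bullet> g y \<le> 0 = \<mu> \<bullet> g x\<close>,
  so the growth of \<open>h\<close> has to come entirely from \<open>\<lambda> \<bullet> f\<close>.  The multiplier \<open>\<lambda>\<close> of the hypothesis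
  is therefore the one that witnesses the weak isolated minimizer.
\<close>

lemma locally_lipschitz_on_inner_left:
  fixes f :: "'a::metric_space \<Rightarrow> 'b::real_inner"
  assumes "open X" "x \<in> X" "locally_lipschitz_on X f"
  obtains r L where "r > 0" "L-lipschitz_on (cball x r) (\<lambda>y. l \<bullet> f y)"
proof -
  obtain r L where r: "r > 0" and L: "L-lipschitz_on (cball x r \<inter> X) f"
    using assms(2,3) unfolding locally_lipschitz_on_def by blast
  obtain s where s: "s > 0" "cball x s \<subseteq> X"
    using assms(1,2) open_contains_cball by blast
  have "L-lipschitz_on (cball x (min r s)) f"
    using s(2) by (intro lipschitz_on_subset[OF L]) auto
  moreover obtain B where "B-lipschitz_on (f ` cball x (min r s)) ((\<bullet>) l)"
    using bounded_linear.lipschitz_boundE[OF bounded_linear_inner_right] .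
  ultimately have "(B * L)-lipschitz_on (cball x (min r s)) (\<lambda>y. l \<bullet> f y)"
    by (rule lipschitz_on_compose2)
  with r s(1) that[of "min r s"] show thesis by simp
qed

lemma eventually_ray_in_cball:
  fixes u :: "'a::real_normed_vector"
  assumes "r > 0"
  shows "\<forall>\<^sub>F t in at_right (0::real). x + t *\<^sub>R u \<in> cball x r"
proof -
  have "((\<lambda>t. x + t *\<^sub>R u) \<longlongrightarrow> x + 0 *\<^sub>R u) (at_right 0)"
    by (intro tendsto_intros)
  moreover have "\<forall>\<^sub>F y in nhds (x + 0 *\<^sub>R u). y \<in> cball x r"
    using assms by (auto simp: eventually_nhds_metric dist_commute intro!: exI[of _ r])
  ultimately show ?thesis
    by (rule eventually_compose_filterlim[rotated])
qed

text \<open>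
  Excluding the value \<open>-\<infinity>\<close> is what allows the lower limits of two functions to be added: with the
  convention \<open>\<infinity> + (-\<infinity>) = \<infinity>\<close>, a positive sum would otherwise carry no information.
\<close>

lemma lower_dini_deriv_neq_minus_infinity:
  assumes "r > 0" and lip: "L-lipschitz_on (cball x r) h"
  shows "lower_dini_deriv h x u \<noteq> -\<infinity>"
proof -
  have "\<forall>\<^sub>F t in at_right (0::real). ereal (- (L * norm u)) \<le> ereal ((h (x + t *\<^sub>R u) - h x) / t)"
    using eventually_ray_in_cball[OF \<open>r > 0\<close>, of x u] eventually_at_right_less[of 0]
  proof eventually_elim
    case (elim t)
    have "\<bar>h (x + t *\<^sub>R u) - h x\<bar> \<le> L * (t * norm u)"
      using lipschitz_onD[OF lip elim(1), of x] elim(2) \<open>r > 0\<close>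
      by (simp add: dist_norm)
    then show ?case
      using elim(2) by (simp add: field_simps)
  qed
  then have "ereal (- (L * norm u)) \<le> lower_dini_deriv h x u"
    unfolding lower_dini_deriv_def by (rule Liminf_bounded)
  then show ?thesis by auto
qed

lemma ereal_add_pos_real_minorants:
  fixes a b :: ereal
  assumes "a + b > 0" "a \<noteq> -\<infinity>" "b \<noteq> -\<infinity>"
  obtains p q :: real where "ereal p < a" "ereal q < b" "p + q > 0"
proof (cases a; cases b)
  fix a' b' assume ab: "a = ereal a'" "b = ereal b'"
  with assms(1) have "a' + b' > 0" by simp
  with ab show thesis
    by (intro that[of "a' - (a' + b') / 4" "b' - (a' + b') / 4"]) (auto simp: field_simps)
next
  fix a' assume "a = ereal a'" "b = \<infinity>"
  then show thesis by (intro that[of "a' - 1" "2 - a'"]) auto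
next
  fix b' assume "a = \<infinity>" "b = ereal b'"
  then show thesis by (intro that[of "2 - b'" "b' - 1"]) auto
next
  assume "a = \<infinity>" "b = \<infinity>"
  then show thesis by (intro that[of 1 1]) auto
qed (use assms in auto)

lemma linear_growth_along_ray_of_lower_dini_deriv_sum:
  assumes "lower_dini_deriv p x u + lower_dini_deriv q x u > 0"
    and "lower_dini_deriv p x u \<noteq> -\<infinity>" "lower_dini_deriv q x u \<noteq> -\<infinity>"
  obtains c where "c > 0"
    and "\<forall>\<^sub>F t in at_right (0::real). p (x + t *\<^sub>R u) + q (x + t *\<^sub>R u) \<ge> p x + q x + c * t"
proof -
  obtain a b where a: "ereal a < lower_dini_deriv p x u"
    and b: "ereal b < lower_dini_deriv q x u" and pos: "a + b > 0"
    using ereal_add_pos_real_minorants[OF assms] .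
  have "\<forall>\<^sub>F t in at_right (0::real). p (x + t *\<^sub>R u) + q (x + t *\<^sub>R u) \<ge> p x + q x + (a + b) * t"
    using less_LiminfD[OF a[unfolded lower_dini_deriv_def]]
      less_LiminfD[OF b[unfolded lower_dini_deriv_def]] eventually_at_right_less[of 0]
  proof eventually_elim
    case (elim t)
    then have "a * t < p (x + t *\<^sub>R u) - p x" "b * t < q (x + t *\<^sub>R u) - q x"
      by (simp_all add: pos_less_divide_eq)
    then show ?case by (simp add: algebra_simps)
  qed
  with pos that show thesis by blast
qed

text \<open>
  Moving the direction from \<open>u\<close> to \<open>v\<close> displaces the point at step length \<open>t\<close> by \<open>t * norm (v - u)\<close>,
  which costs a Lipschitz function at most \<open>L * t * norm (v - u)\<close>.  The loss is proportional to \<open>t\<close>,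
  like the growth itself, so a bound on \<open>norm (v - u)\<close> independent of \<open>t\<close> keeps half the rate.
\<close>

lemma linear_growth_along_nearby_rays:
  fixes h :: "'a::real_normed_vector \<Rightarrow> real"
  assumes "r > 0" and lip: "L-lipschitz_on (cball x r) h" and "norm u = 1"
    and "c > 0" and growth: "\<forall>\<^sub>F t in at_right (0::real). h (x + t *\<^sub>R u) \<ge> h x + c * t"
  obtains d \<delta> where "d > 0" "\<delta> > 0"
    and "\<And>v t. v \<in> ball u d \<Longrightarrow> norm v = 1 \<Longrightarrow> 0 < t \<Longrightarrow> t < \<delta> \<Longrightarrow> h (x + t *\<^sub>R v) \<ge> h x + c / 2 * t"
proof -
  obtain \<delta>0 where \<delta>0: "\<delta>0 > 0" "\<And>t. 0 < t \<Longrightarrow> t < \<delta>0 \<Longrightarrow> h (x + t *\<^sub>R u) \<ge> h x + c * t"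
    using growth by (auto simp: eventually_at_right_field)
  have "L \<ge> 0" using lip by (rule lipschitz_on_nonneg)
  \<comment> \<open>The summand 1 covers \<open>L = 0\<close>.\<close>
  define d where "d = c / (2 * (L + 1))"
  have "d > 0" using \<open>c > 0\<close> \<open>L \<ge> 0\<close> by (simp add: d_def)
  have Ld: "L * d \<le> c / 2"
    using \<open>c > 0\<close> \<open>L \<ge> 0\<close> by (simp add: d_def field_simps)
  have "h (x + t *\<^sub>R v) \<ge> h x + c / 2 * t"
    if v: "v \<in> ball u d" "norm v = 1" and t: "0 < t" "t < min r \<delta>0" for v t
  proof -
    have "dist (h (x + t *\<^sub>R u)) (h (x + t *\<^sub>R v)) \<le> L * dist (x + t *\<^sub>R u) (x + t *\<^sub>R v)"
      using t v(2) \<open>norm u = 1\<close> by (intro lipschitz_onD[OF lip]) (auto simp: dist_norm)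
    also have "dist (x + t *\<^sub>R u) (x + t *\<^sub>R v) = t * dist u v"
      using t(1) by (simp add: dist_norm flip: scaleR_diff_right)
    also have "L * (t * dist u v) \<le> L * (t * d)"
      using v(1) t(1) \<open>L \<ge> 0\<close> by (intro mult_left_mono) auto
    also have "\<dots> = L * d * t" by simp
    also have "\<dots> \<le> c / 2 * t"
      using Ld t(1) by (intro mult_right_mono) auto
    finally have "h (x + t *\<^sub>R u) - c / 2 * t \<le> h (x + t *\<^sub>R v)"
      unfolding dist_real_def by linarith
    moreover have "h (x + t *\<^sub>R u) \<ge> h x + c * t"
      using \<delta>0(2) t by simp
    ultimately show ?thesis by (simp add: algebra_simps)
  qed
  with \<open>d > 0\<close> \<open>r > 0\<close> \<delta>0(1) that[of d "min r \<delta>0"] show thesis by simp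
qed

text \<open>
  Growth along every single ray says nothing uniform by itself.  Since it extends to open bundles of
  rays, compactness of the unit sphere reduces the rates and step lengths to finitely many,
  whose minima serve all directions.
\<close>

lemma linear_growth_near_point:
  fixes h :: "'a::euclidean_space \<Rightarrow> real"
  assumes "r > 0" and lip: "L-lipschitz_on (cball x r) h"
    and growth: "\<And>u. norm u = 1 \<Longrightarrow>
      \<exists>c>0. \<forall>\<^sub>F t in at_right (0::real). h (x + t *\<^sub>R u) \<ge> h x + c * t"
  obtains \<epsilon> where "\<epsilon> > 0" "\<And>y. y \<in> ball x \<epsilon> \<Longrightarrow> h y \<ge> h x + \<epsilon> * norm (y - x)"
proof -
  have "\<exists>d>0. \<exists>e>0. \<forall>v\<in>ball u d. norm v = 1 \<longrightarrow>
          (\<forall>t. 0 < t \<and> t < e \<longrightarrow> h (x + t *\<^sub>R v) \<ge> h x + e * t)" if u: "u \<in> sphere 0 1" for u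
  proof -
    have "norm u = 1" using u by simp
    with growth obtain c where c: "c > 0"
      "\<forall>\<^sub>F t in at_right (0::real). h (x + t *\<^sub>R u) \<ge> h x + c * t" by blast
    obtain d \<delta> where d: "d > 0" "\<delta> > 0"
      and near: "\<And>v t. v \<in> ball u d \<Longrightarrow> norm v = 1 \<Longrightarrow> 0 < t \<Longrightarrow> t < \<delta> \<Longrightarrow>
        h (x + t *\<^sub>R v) \<ge> h x + c / 2 * t"
      using linear_growth_along_nearby_rays[OF \<open>r > 0\<close> lip \<open>norm u = 1\<close> c] by blast
    \<comment> \<open>One number can be both rate and step length, since either may be decreased.\<close>
    have "h (x + t *\<^sub>R v) \<ge> h x + min (c / 2) \<delta> * t"
      if v: "v \<in> ball u d" "norm v = 1" and t: "0 < t" "t < min (c / 2) \<delta>" for v t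
    proof -
      have "min (c / 2) \<delta> * t \<le> c / 2 * t" using t(1) by (intro mult_right_mono) auto
      with near[OF v t(1)] t(2) show ?thesis by simp
    qed
    with d c(1) show ?thesis
      by (intro exI[of _ d] exI[of _ "min (c / 2) \<delta>"] conjI) auto
  qed
  then obtain d e where d: "\<And>u. u \<in> sphere 0 1 \<Longrightarrow> d u > 0" and e: "\<And>u. u \<in> sphere 0 1 \<Longrightarrow> e u > 0"
    and near: "\<And>u v t. u \<in> sphere 0 1 \<Longrightarrow> v \<in> ball u (d u) \<Longrightarrow> norm v = 1 \<Longrightarrow> 0 < t \<Longrightarrow> t < e u \<Longrightarrow>
      h (x + t *\<^sub>R v) \<ge> h x + e u * t"
    by metis
  have "sphere 0 1 \<subseteq> (\<Union>u\<in>sphere 0 1. ball u (d u))"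
    using d by force
  then obtain U where U: "U \<subseteq> sphere 0 1" "finite U" and cover: "sphere 0 1 \<subseteq> (\<Union>u\<in>U. ball u (d u))"
    using compactE_image[OF compact_sphere, of "sphere 0 1" "\<lambda>u. ball u (d u)" 0 1] by auto
  \<comment> \<open>The extra element 1 only keeps the set visibly nonempty.\<close>
  define \<epsilon> where "\<epsilon> = Min (insert 1 (e ` U))"
  have "\<epsilon> > 0" using U e by (auto simp: \<epsilon>_def)
  moreover have "h y \<ge> h x + \<epsilon> * norm (y - x)" if y: "y \<in> ball x \<epsilon>" for y
  proof (cases "y = x")
    case False
    define t v where "t = norm (y - x)" and "v = (y - x) /\<^sub>R norm (y - x)"
    have t: "t > 0" "t < \<epsilon>" and v: "norm v = 1" and y_eq: "y = x + t *\<^sub>R v"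
      using False y by (auto simp: t_def v_def dist_norm norm_minus_commute)
    obtain u where u: "u \<in> U" "v \<in> ball u (d u)"
      using cover v by auto
    have "\<epsilon> \<le> e u" using u(1) U(2) by (simp add: \<epsilon>_def)
    then have "\<epsilon> * t \<le> e u * t" using t(1) by (intro mult_right_mono) auto
    moreover have "h y \<ge> h x + e u * t"
      by (subst y_eq) (use near[of u v t] u U(1) v t \<open>\<epsilon> \<le> e u\<close> in auto)
    ultimately show ?thesis by (simp flip: t_def)
  qed simp
  ultimately show thesis by (rule that)
qed

theorem theorem7:
  fixes X :: "(real ^ 's) set"
    and f :: "real ^ 's \<Rightarrow> real ^ 'n"
    and g :: "real ^ 's \<Rightarrow> real ^ 'm"
    and C :: "(real ^ 'n) set"
    and K :: "(real ^ 'm) set"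
    and xbar :: "real ^ 's"
  assumes "open X"
    and "closed_convex_pointed_cone C"
    and "closed_convex_pointed_cone K"
    and "interior C \<noteq> {}"
    and "xbar \<in> X"
    and "g xbar \<in> uminus ` K"
    and "locally_lipschitz_on X f"
    and "locally_lipschitz_on X g"
    and "\<exists>lbar \<in> positive_polar C. \<exists>mbar \<in> positive_polar K.
           lbar \<noteq> 0 \<and> mbar \<bullet> g xbar = 0 \<and>
           (\<forall>u. u \<noteq> 0 \<longrightarrow>
              lower_dini_deriv (\<lambda>x. lbar \<bullet> f x) xbar u
                + lower_dini_deriv (\<lambda>x. mbar \<bullet> g x) xbar u > 0)"
  shows "weak_isolated_local_minimizer X f g C K xbar"
proof -
  obtain l m where l: "l \<in> positive_polar C" "l \<noteq> 0" and m: "m \<in> positive_polar K"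
    and compl: "m \<bullet> g xbar = 0"
    and dini: "\<And>u. u \<noteq> 0 \<Longrightarrow> lower_dini_deriv (\<lambda>x. l \<bullet> f x) xbar u
                 + lower_dini_deriv (\<lambda>x. m \<bullet> g x) xbar u > 0"
    using assms(9) by blast
  obtain r1 L1 where r1: "r1 > 0" and L1: "L1-lipschitz_on (cball xbar r1) (\<lambda>x. l \<bullet> f x)"
    using locally_lipschitz_on_inner_left[OF assms(1,5,7)] .
  obtain r2 L2 where r2: "r2 > 0" and L2: "L2-lipschitz_on (cball xbar r2) (\<lambda>x. m \<bullet> g x)"
    using locally_lipschitz_on_inner_left[OF assms(1,5,8)] .
  define h where "h = (\<lambda>x. l \<bullet> f x + m \<bullet> g x)"
  have "(L1 + L2)-lipschitz_on (cball xbar (min r1 r2)) h"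
    unfolding h_def
    by (intro lipschitz_on_add lipschitz_on_subset[OF L1] lipschitz_on_subset[OF L2]) auto
  moreover have "\<exists>c>0. \<forall>\<^sub>F t in at_right (0::real). h (xbar + t *\<^sub>R u) \<ge> h xbar + c * t"
    if "norm u = 1" for u
  proof -
    have "u \<noteq> 0" using that by auto
    from linear_growth_along_ray_of_lower_dini_deriv_sum[OF dini[OF this]
        lower_dini_deriv_neq_minus_infinity[OF r1 L1] lower_dini_deriv_neq_minus_infinity[OF r2 L2]]
    show ?thesis unfolding h_def by blast
  qed
  ultimately obtain \<epsilon> where \<epsilon>: "\<epsilon> > 0" "\<And>y. y \<in> ball xbar \<epsilon> \<Longrightarrow> h y \<ge> h xbar + \<epsilon> * norm (y - xbar)"
    using linear_growth_near_point[of "min r1 r2" "L1 + L2" xbar h] r1 r2 by auto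
  have "l \<bullet> f y \<ge> l \<bullet> f xbar + \<epsilon> * norm (y - xbar)"
    if y: "y \<in> ball xbar \<epsilon> \<inter> feasible_set X g K" for y
  proof -
    have "m \<bullet> g y \<le> 0"
      using y m by (auto simp: feasible_set_def positive_polar_def)
    with \<epsilon>(2)[of y] y compl show ?thesis by (simp add: h_def)
  qed
  moreover have "xbar \<in> feasible_set X g K"
    using assms(5,6) by (simp add: feasible_set_def)
  ultimately show ?thesis
    unfolding weak_isolated_local_minimizer_def using l \<epsilon>(1) by blast
qed

end
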